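(* Let $\gamma(x,t)\in\mathbb{R}^2$ be a motion of an arc-length parametrized curve with angle function $\theta(x,t)$ (so that $\theta$ satisfies the potential mKdV equation $\theta_t+\frac12(\theta_x)^3+\theta_{xxx}=0$). Let $\lambda$ be a non-zero real constant and let $\widetilde\theta(x,t)$ be a Bäcklund transform of $\theta$, i.e. a function satisfying $$\frac{\partial}{\partial x}\left(\frac{\widetilde\theta+\theta}{2}\right)=2\lambda\sin\frac{\widetilde\theta-\theta}{2},$$ $$\frac{\partial}{\partial t}\left(\frac{\widetilde\theta+\theta}{2}\right)=-\lambda\left\{(\theta_x)^2+8\lambda^2\right\}\sin\frac{\widetilde\theta-\theta}{2}+2\lambda\theta_{xx}\cos\frac{\widetilde\theta-\theta}{2}+4\lambda^2\theta_x .$$ Then $$\widetilde\gamma(x,t)=\gamma(x,t)+\frac1\lambda\,R\left(\frac{\widetilde\theta(x,t)-\theta(x,t)}{2}\right)\gamma'(x,t)$$ is a motion of an arc-length parametrized curve with angle function $\widetilde\theta(x,t)$.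
   Context: $'$ denotes $\partial/\partial x$; $R(\phi)=\begin{pmatrix}\cos\phi&-\sin\phi\\ \sin\phi&\cos\phi\end{pmatrix}$; all functions are smooth and $\theta,\widetilde\theta$ are real valued. A smooth $\gamma(x,t)\in\mathbb{R}^2$ is called a motion of an arc-length parametrized curve with angle function $\theta(x,t)$ if $\gamma'={}^t(\cos\theta,\sin\theta)$ (so $|\gamma'|=1$) and, with $\kappa=\theta_x$, $$\gamma''=\begin{bmatrix}0&-\kappa\\ \kappa&0\end{bmatrix}\gamma',\qquad \frac{\partial}{\partial t}\gamma'=\begin{bmatrix}0&\kappa''+\frac{\kappa^3}{2}\\ -\kappa''-\frac{\kappa^3}{2}&0\end{bmatrix}\gamma'.$$ *)

theory Defs
  imports "HOL-Analysis.Analysis"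
begin

primrec Ck_on :: "nat \<Rightarrow> 'a::real_normed_vector set \<Rightarrow> ('a \<Rightarrow> 'b::real_normed_vector) \<Rightarrow> bool" where
  "Ck_on 0 S f \<longleftrightarrow> continuous_on S f"
| "Ck_on (Suc k) S f \<longleftrightarrow>
     (\<forall>p\<in>S. f differentiable (at p)) \<and>
     (\<forall>v. Ck_on k S (\<lambda>p. frechet_derivative f (at p) v))"

text \<open>Directional derivatives in every fixed direction are iterated, so for an open set \<open>S\<close>
  of a finite-dimensional space this is the usual notion of a \<open>C\<^sup>\<infinity>\<close> function on \<open>S\<close>.\<close>

definition smooth_on :: "'a::real_normed_vector set \<Rightarrow> ('a \<Rightarrow> 'b::real_normed_vector) \<Rightarrow> bool" where
  "smooth_on S f \<longleftrightarrow> (\<forall>k. Ck_on k S f)"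

definition dx :: "(real \<Rightarrow> real \<Rightarrow> 'b::real_normed_vector) \<Rightarrow> real \<Rightarrow> real \<Rightarrow> 'b" where
  "dx f x t = vector_derivative (\<lambda>s. f s t) (at x)"

definition dt :: "(real \<Rightarrow> real \<Rightarrow> 'b::real_normed_vector) \<Rightarrow> real \<Rightarrow> real \<Rightarrow> 'b" where
  "dt f x t = vector_derivative (\<lambda>s. f x s) (at t)"

definition rot :: "real \<Rightarrow> real^2^2" where
  "rot \<phi> = vector [vector [cos \<phi>, - sin \<phi>], vector [sin \<phi>, cos \<phi>]]"

text \<open>\<open>D\<close> is the domain of the variables \<open>(x, t)\<close>. The partial derivatives at a point of an
  open \<open>D\<close> do not depend on the values of the functions outside \<open>D\<close>.\<close>

definition curve_motion ::
  "(real \<times> real) set \<Rightarrow> (real \<Rightarrow> real \<Rightarrow> real^2) \<Rightarrow> (real \<Rightarrow> real \<Rightarrow> real) \<Rightarrow> bool" where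
  "curve_motion D \<gamma> \<theta> \<longleftrightarrow>
     smooth_on D (\<lambda>(x, t). \<gamma> x t) \<and>
     smooth_on D (\<lambda>(x, t). \<theta> x t) \<and>
     (\<forall>(x, t)\<in>D. dx \<gamma> x t = vector [cos (\<theta> x t), sin (\<theta> x t)]) \<and>
     (let \<kappa> = dx \<theta> in
       \<forall>(x, t)\<in>D.
         dx (dx \<gamma>) x t = vector [vector [0, - \<kappa> x t], vector [\<kappa> x t, 0]] *v dx \<gamma> x t \<and>
         dt (dx \<gamma>) x t =
           vector [vector [0, dx (dx \<kappa>) x t + (\<kappa> x t)^3 / 2],
                   vector [- dx (dx \<kappa>) x t - (\<kappa> x t)^3 / 2, 0]] *v dx \<gamma> x t)"

definition backlund_transform ::
  "(real \<times> real) set \<Rightarrow> real \<Rightarrow> (real \<Rightarrow> real \<Rightarrow> real) \<Rightarrow> (real \<Rightarrow> real \<Rightarrow> real) \<Rightarrow> bool" where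
  "backlund_transform D lam \<theta> \<theta>' \<longleftrightarrow>
     smooth_on D (\<lambda>(x, t). \<theta>' x t) \<and>
     (\<forall>(x, t)\<in>D.
       dx (\<lambda>x t. (\<theta>' x t + \<theta> x t) / 2) x t = 2 * lam * sin ((\<theta>' x t - \<theta> x t) / 2) \<and>
       dt (\<lambda>x t. (\<theta>' x t + \<theta> x t) / 2) x t =
         - lam * ((dx \<theta> x t)^2 + 8 * lam^2) * sin ((\<theta>' x t - \<theta> x t) / 2)
         + 2 * lam * dx (dx \<theta>) x t * cos ((\<theta>' x t - \<theta> x t) / 2)
         + 4 * lam^2 * dx \<theta> x t)"

end

theory Submission
  imports Defs
begin

text \<open>Put \<open>\<phi> = (\<theta>' + \<theta>) / 2\<close> and \<open>\<psi> = (\<theta>' - \<theta>) / 2\<close>. The transformed curve is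
  \<open>\<gamma> + (cos \<phi>, sin \<phi>) / \<lambda>\<close>, and \<open>\<phi>\<^sub>x = 2 \<lambda> sin \<psi>\<close> turns its \<open>x\<close>-derivative
  into \<open>(cos (\<phi> + \<psi>), sin (\<phi> + \<psi>))\<close>. What remains is the potential mKdV equation for
  \<open>\<theta>'\<close>: differentiating \<open>\<theta>'\<^sub>x = 4 \<lambda> sin \<psi> - \<theta>\<^sub>x\<close> twice in \<open>x\<close> expresses everything
  by \<open>sin \<psi>\<close>, \<open>cos \<psi>\<close> and the \<open>x\<close>-derivatives of \<open>\<theta>\<close>, and the equation becomes the mKdV
  equation for \<open>\<theta>\<close> together with the second Baecklund equation.\<close>

section \<open>Smooth functions\<close>

lemma Ck_on_Suc_imp_Ck_on: "Ck_on (Suc k) S f \<Longrightarrow> Ck_on k S f"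
proof (induction k arbitrary: f)
  case 0
  then show ?case
    by (auto intro!: continuous_at_imp_continuous_on differentiable_imp_continuous_within)
next
  case (Suc k)
  then show ?case by (metis Ck_on.simps(2))
qed

text \<open>On an open set derivatives are local, so values outside \<open>S\<close> never matter.
  Both functions are generalized in the induction because their directional derivatives take their
  places.\<close>

lemma Ck_on_cong:
  assumes "open S" "\<And>p. p \<in> S \<Longrightarrow> f p = g p" "Ck_on k S f"
  shows "Ck_on k S g"
  using assms(2,3)
proof (induction k arbitrary: f g)
  case 0
  then show ?case by (metis Ck_on.simps(1) continuous_on_cong)
next
  case (Suc k)
  have der: "(g has_derivative frechet_derivative f (at p)) (at p)" if "p \<in> S" for p
    using Suc.prems that assms(1)
    by (auto intro: has_derivative_transform_within_open[of f] simp: frechet_derivative_works)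
  have "frechet_derivative f (at p) v = frechet_derivative g (at p) v" if "p \<in> S" for p v
    using frechet_derivative_at[OF der[OF that]] by simp
  then have "Ck_on k S (\<lambda>p. frechet_derivative g (at p) v)" for v
    using Suc.IH[of "\<lambda>p. frechet_derivative f (at p) v"] Suc.prems(2) by simp
  then show ?case
    using der by (auto simp: differentiable_def)
qed

text \<open>Lets an explicit derivative formula stand in for \<open>frechet_derivative\<close>:
  derivatives are unique, so the two agree on \<open>S\<close>.\<close>

lemma Ck_on_SucI:
  assumes "open S"
    and "\<And>p. p \<in> S \<Longrightarrow> (f has_derivative f' p) (at p)"
    and "\<And>v. Ck_on k S (\<lambda>p. f' p v)"
  shows "Ck_on (Suc k) S f"
proof -
  have "f' p v = frechet_derivative f (at p) v" if "p \<in> S" for p v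
    using frechet_derivative_at[OF assms(2)[OF that]] by simp
  then have "Ck_on k S (\<lambda>p. frechet_derivative f (at p) v)" for v
    by (rule Ck_on_cong[OF assms(1) _ assms(3)[of v]])
  then show ?thesis
    using assms(2) by (auto simp: differentiable_def)
qed

lemma Ck_on_Suc_has_derivative:
  "Ck_on (Suc k) S f \<Longrightarrow> p \<in> S \<Longrightarrow> (f has_derivative frechet_derivative f (at p)) (at p)"
  by (simp add: frechet_derivative_works)

lemma Ck_on_add:
  assumes "open S"
  shows "Ck_on k S f \<Longrightarrow> Ck_on k S g \<Longrightarrow> Ck_on k S (\<lambda>p. f p + g p)"
proof (induction k arbitrary: f g)
  case 0
  then show ?case by (simp add: continuous_on_add)
next
  case (Suc k)
  show ?case
    by (rule Ck_on_SucI[OF assms has_derivative_add[OF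
            Ck_on_Suc_has_derivative[OF Suc.prems(1)] Ck_on_Suc_has_derivative[OF Suc.prems(2)]]])
      (use Suc in auto)
qed

lemma Ck_on_bounded_linear:
  assumes "open S" "bounded_linear h"
  shows "Ck_on k S f \<Longrightarrow> Ck_on k S (\<lambda>p. h (f p))"
proof (induction k arbitrary: f)
  case 0
  then show ?case by (simp add: bounded_linear.continuous_on[OF assms(2)])
next
  case (Suc k)
  show ?case
    by (rule Ck_on_SucI[OF assms(1) bounded_linear.has_derivative[OF assms(2)
            Ck_on_Suc_has_derivative[OF Suc.prems]]])
      (use Suc in auto)
qed

lemma Ck_on_mult:
  fixes f g :: "'a::real_normed_vector \<Rightarrow> 'b::real_normed_algebra"
  assumes "open S"
  shows "Ck_on k S f \<Longrightarrow> Ck_on k S g \<Longrightarrow> Ck_on k S (\<lambda>p. f p * g p)"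
proof (induction k arbitrary: f g)
  case 0
  then show ?case by (simp add: continuous_on_mult)
next
  case (Suc k)
  \<comment> \<open>The product rule brings back the undifferentiated factors, so they too are
    needed at level \<open>k\<close>.\<close>
  have "Ck_on k S f" "Ck_on k S g"
    using Suc.prems[THEN Ck_on_Suc_imp_Ck_on] .
  with Suc.prems show ?case
    by (intro Ck_on_SucI[OF assms has_derivative_mult[OF
            Ck_on_Suc_has_derivative[OF Suc.prems(1)] Ck_on_Suc_has_derivative[OF Suc.prems(2)]]]
        Ck_on_add[OF assms] Suc.IH) auto
qed

text \<open>Sine and cosine go through one induction, since the derivative of each contains the
  other.\<close>

lemma Ck_on_sin_cos:
  fixes f :: "'a::real_normed_vector \<Rightarrow> real"
  assumes "open S"
  shows "Ck_on k S f \<Longrightarrow> Ck_on k S (\<lambda>p. sin (f p)) \<and> Ck_on k S (\<lambda>p. cos (f p))"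
proof (induction k)
  case 0
  then show ?case by (auto intro: continuous_intros)
next
  case (Suc k)
  have sc: "Ck_on k S (\<lambda>p. sin (f p))" "Ck_on k S (\<lambda>p. cos (f p))"
    using Suc Ck_on_Suc_imp_Ck_on by blast+
  have f': "Ck_on k S (\<lambda>p. frechet_derivative f (at p) v)" for v
    using Suc.prems by simp
  have msin: "Ck_on k S (\<lambda>p. - sin (f p))"
    using Ck_on_bounded_linear[OF assms bounded_linear_minus[OF bounded_linear_ident] sc(1)] .
  have "Ck_on (Suc k) S (\<lambda>p. sin (f p))"
  proof (rule Ck_on_SucI[OF assms])
    show "((\<lambda>p. sin (f p)) has_derivative
        (\<lambda>v. frechet_derivative f (at p) v * cos (f p))) (at p)" if "p \<in> S" for p
      using has_derivative_sin[OF Ck_on_Suc_has_derivative[OF Suc.prems that]] .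
  qed (intro Ck_on_mult[OF assms] sc f')
  moreover have "Ck_on (Suc k) S (\<lambda>p. cos (f p))"
  proof (rule Ck_on_SucI[OF assms])
    show "((\<lambda>p. cos (f p)) has_derivative
        (\<lambda>v. frechet_derivative f (at p) v * - sin (f p))) (at p)" if "p \<in> S" for p
      using has_derivative_cos[OF Ck_on_Suc_has_derivative[OF Suc.prems that]] .
  qed (intro Ck_on_mult[OF assms] msin f')
  ultimately show ?case ..
qed

lemma smooth_on_cong:
  "open S \<Longrightarrow> (\<And>p. p \<in> S \<Longrightarrow> f p = g p) \<Longrightarrow> smooth_on S f \<Longrightarrow> smooth_on S g"
  unfolding smooth_on_def using Ck_on_cong by blast

lemma smooth_on_add:
  "open S \<Longrightarrow> smooth_on S f \<Longrightarrow> smooth_on S g \<Longrightarrow> smooth_on S (\<lambda>p. f p + g p)"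
  unfolding smooth_on_def using Ck_on_add by blast

lemma smooth_on_bounded_linear:
  "open S \<Longrightarrow> bounded_linear h \<Longrightarrow> smooth_on S f \<Longrightarrow> smooth_on S (\<lambda>p. h (f p))"
  unfolding smooth_on_def using Ck_on_bounded_linear by blast

lemma smooth_on_sin_cos:
  fixes f :: "'a::real_normed_vector \<Rightarrow> real"
  assumes "open S" "smooth_on S f"
  shows "smooth_on S (\<lambda>p. sin (f p))" "smooth_on S (\<lambda>p. cos (f p))"
  using assms Ck_on_sin_cos unfolding smooth_on_def by blast+

lemma smooth_on_has_derivative:
  "smooth_on S f \<Longrightarrow> p \<in> S \<Longrightarrow> (f has_derivative frechet_derivative f (at p)) (at p)"
  unfolding smooth_on_def using Ck_on_Suc_has_derivative by blast

lemma smooth_on_frechet_derivative: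
  "smooth_on S f \<Longrightarrow> smooth_on S (\<lambda>p. frechet_derivative f (at p) v)"
  unfolding smooth_on_def by (metis Ck_on.simps(2))

section \<open>Partial derivatives\<close>

lemma open_slices:
  fixes D :: "(real \<times> real) set"
  assumes "open D"
  shows "open {s. (s, t) \<in> D}" "open {s. (x, s) \<in> D}"
proof -
  have "continuous_on UNIV (\<lambda>s::real. (s, t))" "continuous_on UNIV (\<lambda>s::real. (x, s))"
    by (intro continuous_intros)+
  then show "open {s. (s, t) \<in> D}" "open {s. (x, s) \<in> D}"
    using assms by (auto dest: open_vimage simp: vimage_def)
qed

text \<open>The slice of \<open>D\<close> through the point is open, so an equation known only on
  \<open>D\<close> may be differentiated there.\<close>

lemma dx_eqI:
  assumes "open D" "(x, t) \<in> D" "\<And>s r. (s, r) \<in> D \<Longrightarrow> f s r = g s r"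
    and "((\<lambda>s. g s t) has_vector_derivative d) (at x)"
  shows "dx f x t = d"
proof -
  have "((\<lambda>s. f s t) has_vector_derivative d) (at x)"
    by (rule has_vector_derivative_transform_within_open[OF assms(4) open_slices(1)[OF assms(1), of t]])
      (use assms in auto)
  then show ?thesis unfolding dx_def by (rule vector_derivative_at)
qed

lemma dt_eqI:
  assumes "open D" "(x, t) \<in> D" "\<And>s r. (s, r) \<in> D \<Longrightarrow> f s r = g s r"
    and "((\<lambda>s. g x s) has_vector_derivative d) (at t)"
  shows "dt f x t = d"
proof -
  have "((\<lambda>s. f x s) has_vector_derivative d) (at t)"
    by (rule has_vector_derivative_transform_within_open[OF assms(4) open_slices(2)[OF assms(1), of x]])
      (use assms in auto)
  then show ?thesis unfolding dt_def by (rule vector_derivative_at)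
qed

text \<open>Chain rule along the two coordinate lines: partial derivatives are the total derivative
  applied to the basis vectors.\<close>

lemma smooth_on_partial_derivatives:
  assumes "smooth_on D (\<lambda>(x, t). f x t)" "(x, t) \<in> D"
  defines "F \<equiv> frechet_derivative (\<lambda>(x, t). f x t) (at (x, t))"
  shows "((\<lambda>s. f s t) has_vector_derivative F (1, 0)) (at x)"
    and "((\<lambda>s. f x s) has_vector_derivative F (0, 1)) (at t)"
proof -
  have F: "((\<lambda>(x, t). f x t) has_derivative F) (at (x, t))"
    unfolding F_def by (rule smooth_on_has_derivative[OF assms(1,2)])
  have lin: "F (h *\<^sub>R v) = h *\<^sub>R F v" for h v
    using has_derivative_linear[OF F] by (rule linear_cmul)
  have "((\<lambda>s. (s, t)) has_derivative (\<lambda>h. (h, 0))) (at x)"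
    "((\<lambda>s. (x, s)) has_derivative (\<lambda>h. (0, h))) (at t)"
    by (auto intro!: derivative_eq_intros)
  from has_derivative_compose[OF this(1) F] has_derivative_compose[OF this(2) F]
  show "((\<lambda>s. f s t) has_vector_derivative F (1, 0)) (at x)"
    "((\<lambda>s. f x s) has_vector_derivative F (0, 1)) (at t)"
    by (simp_all add: has_vector_derivative_def flip: lin)
qed

lemma dx_has_vector_derivative:
  "smooth_on D (\<lambda>(x, t). f x t) \<Longrightarrow> (x, t) \<in> D \<Longrightarrow>
    ((\<lambda>s. f s t) has_vector_derivative dx f x t) (at x)"
  unfolding dx_def
  by (metis smooth_on_partial_derivatives(1) vector_derivative_at)

lemma dt_has_vector_derivative:
  "smooth_on D (\<lambda>(x, t). f x t) \<Longrightarrow> (x, t) \<in> D \<Longrightarrow>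
    ((\<lambda>s. f x s) has_vector_derivative dt f x t) (at t)"
  unfolding dt_def
  by (metis smooth_on_partial_derivatives(2) vector_derivative_at)

lemma smooth_on_dx:
  assumes "open D" "smooth_on D (\<lambda>(x, t). f x t)"
  shows "smooth_on D (\<lambda>(x, t). dx f x t)"
proof (rule smooth_on_cong[OF assms(1) _ smooth_on_frechet_derivative[OF assms(2), of "(1, 0)"]])
  fix p assume "p \<in> D"
  then show "frechet_derivative (\<lambda>(x, t). f x t) (at p) (1, 0) = (case p of (x, t) \<Rightarrow> dx f x t)"
    using vector_derivative_at[OF smooth_on_partial_derivatives(1)[OF assms(2)]]
    by (cases p) (simp add: dx_def)
qed

section \<open>Tangent fields given by an angle\<close>

text \<open>Expansion in constant basis vectors, to which the calculus rules for sums and scalar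
  multiples apply.\<close>

lemma vector_2_eq: "vector [a, b] = a *\<^sub>R axis 1 1 + b *\<^sub>R (axis 2 1 :: real^2)"
  by (simp add: vec_eq_iff forall_2 axis_def)

lemma has_vector_derivative_unit_vector:
  assumes "(f has_vector_derivative d) (at s)"
  shows "((\<lambda>s. vector [cos (f s), sin (f s)] :: real^2) has_vector_derivative
    d *\<^sub>R vector [- sin (f s), cos (f s)]) (at s)"
proof -
  have f: "(f has_real_derivative d) (at s)"
    using assms by (simp add: has_real_derivative_iff_has_vector_derivative)
  show ?thesis
    unfolding vector_2_eq by (rule f derivative_eq_intros refl)+ (simp add: algebra_simps)
qed

lemma smooth_on_unit_vector:
  fixes f :: "'a::real_normed_vector \<Rightarrow> real"
  assumes "open S" "smooth_on S f"
  shows "smooth_on S (\<lambda>p. vector [cos (f p), sin (f p)] :: real^2)"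
proof -
  show ?thesis
    unfolding vector_2_eq
    by (intro smooth_on_add smooth_on_bounded_linear[OF _ bounded_linear_scaleR_left]
        smooth_on_sin_cos assms)
qed

lemma rot_mult_unit_vector:
  "rot \<phi> *v vector [cos \<theta>, sin \<theta>] = vector [cos (\<phi> + \<theta>), sin (\<phi> + \<theta>)]"
  by (simp add: rot_def vec_eq_iff forall_2 matrix_vector_mult_def sum_2 cos_add sin_add)

text \<open>The matrix is \<open>a\<close> times a quarter turn, which takes the unit tangent to the
  unit normal.\<close>

lemma antisymmetric_mult_unit_vector:
  fixes a :: real
  shows "vector [vector [0, - a], vector [a, 0]] *v (vector [cos \<theta>, sin \<theta>] :: real^2)
    = a *\<^sub>R (vector [- sin \<theta>, cos \<theta>] :: real^2)"
  by (simp add: vec_eq_iff forall_2 matrix_vector_mult_def sum_2)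

lemma scaleR_normal_eq_iff:
  "a *\<^sub>R vector [- sin \<theta>, cos \<theta>] = b *\<^sub>R (vector [- sin \<theta>, cos \<theta>] :: real^2) \<longleftrightarrow> a = b"
proof -
  have "vector [- sin \<theta>, cos \<theta>] \<noteq> (0 :: real^2)"
    using sin_zero_abs_cos_one[of \<theta>] by (auto simp: vec_eq_iff forall_2)
  then show ?thesis by simp
qed

text \<open>Both vector equations compare multiples of the unit normal: the one in \<open>x\<close> holds
  automatically, the one in \<open>t\<close> reduces to the potential mKdV equation.\<close>

lemma curve_motion_iff_mkdv:
  assumes "open D"
  shows "curve_motion D \<gamma> \<theta> \<longleftrightarrow>
     smooth_on D (\<lambda>(x, t). \<gamma> x t) \<and> smooth_on D (\<lambda>(x, t). \<theta> x t) \<and>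
     (\<forall>x t. (x, t) \<in> D \<longrightarrow> dx \<gamma> x t = vector [cos (\<theta> x t), sin (\<theta> x t)] \<and>
       dt \<theta> x t = - dx (dx (dx \<theta>)) x t - (dx \<theta> x t)^3 / 2)"
proof -
  have "dx (dx \<gamma>) x t = vector [vector [0, - dx \<theta> x t], vector [dx \<theta> x t, 0]] *v dx \<gamma> x t"
    "dt (dx \<gamma>) x t =
           vector [vector [0, dx (dx (dx \<theta>)) x t + (dx \<theta> x t)^3 / 2],
                   vector [- dx (dx (dx \<theta>)) x t - (dx \<theta> x t)^3 / 2, 0]] *v dx \<gamma> x t
     \<longleftrightarrow> dt \<theta> x t = - dx (dx (dx \<theta>)) x t - (dx \<theta> x t)^3 / 2"
    if sm: "smooth_on D (\<lambda>(x, t). \<theta> x t)" and mem: "(x, t) \<in> D"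
      and tang: "\<And>x t. (x, t) \<in> D \<Longrightarrow> dx \<gamma> x t = vector [cos (\<theta> x t), sin (\<theta> x t)]" for x t
  proof -
    have "dx (dx \<gamma>) x t = dx \<theta> x t *\<^sub>R vector [- sin (\<theta> x t), cos (\<theta> x t)]"
      by (rule dx_eqI[OF assms mem tang], assumption)
        (rule has_vector_derivative_unit_vector[OF dx_has_vector_derivative[OF sm mem]])
    then show "dx (dx \<gamma>) x t
        = vector [vector [0, - dx \<theta> x t], vector [dx \<theta> x t, 0]] *v dx \<gamma> x t"
      by (simp add: tang[OF mem] antisymmetric_mult_unit_vector)
    have dt: "dt (dx \<gamma>) x t = dt \<theta> x t *\<^sub>R vector [- sin (\<theta> x t), cos (\<theta> x t)]"
      by (rule dt_eqI[OF assms mem tang], assumption)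
        (rule has_vector_derivative_unit_vector[OF dt_has_vector_derivative[OF sm mem]])
    \<comment> \<open>Writes the upper right entry as \<open>- a\<close>, where \<open>a\<close> is
      the lower left one, to match \<open>antisymmetric_mult_unit_vector\<close>.\<close>
    have "dx (dx (dx \<theta>)) x t + (dx \<theta> x t)^3 / 2 = - (- dx (dx (dx \<theta>)) x t - (dx \<theta> x t)^3 / 2)"
      by simp
    then show "dt (dx \<gamma>) x t =
           vector [vector [0, dx (dx (dx \<theta>)) x t + (dx \<theta> x t)^3 / 2],
                   vector [- dx (dx (dx \<theta>)) x t - (dx \<theta> x t)^3 / 2, 0]] *v dx \<gamma> x t
     \<longleftrightarrow> dt \<theta> x t = - dx (dx (dx \<theta>)) x t - (dx \<theta> x t)^3 / 2"
      by (simp only: dt tang[OF mem] antisymmetric_mult_unit_vector scaleR_normal_eq_iff)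
  qed
  then show ?thesis
    unfolding curve_motion_def Let_def by fast
qed

section \<open>The Baecklund transformation\<close>

lemma backlund_transform_mkdv:
  assumes "open D" "smooth_on D (\<lambda>(x, t). \<theta> x t)" "backlund_transform D lam \<theta> \<theta>'"
    and mkdv: "\<And>x t. (x, t) \<in> D \<Longrightarrow> dt \<theta> x t = - dx (dx (dx \<theta>)) x t - (dx \<theta> x t)^3 / 2"
    and mem: "(x, t) \<in> D"
  shows "dt \<theta>' x t = - dx (dx (dx \<theta>')) x t - (dx \<theta>' x t)^3 / 2"
proof -
  define \<psi> where "\<psi> x t = (\<theta>' x t - \<theta> x t) / 2" for x t
  note smooth = assms(2)
  have smooth': "smooth_on D (\<lambda>(x, t). \<theta>' x t)"
    using assms(3) by (simp add: backlund_transform_def)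
  note partials =
    dx_has_vector_derivative[OF smooth]
    dx_has_vector_derivative[OF smooth_on_dx[OF assms(1) smooth]]
    dx_has_vector_derivative[OF smooth_on_dx[OF assms(1) smooth_on_dx[OF assms(1) smooth]]]
    dx_has_vector_derivative[OF smooth']
    dt_has_vector_derivative[OF smooth]
    dt_has_vector_derivative[OF smooth']
  \<comment> \<open>For real-valued functions the vector derivatives are restated as real ones, the
    form produced by the \<open>derivative_eq_intros\<close> rules.\<close>
  note der = partials[unfolded has_real_derivative_iff_has_vector_derivative[symmetric]]
  have "dx (\<lambda>x t. (\<theta>' x t + \<theta> x t) / 2) x t = (dx \<theta>' x t + dx \<theta> x t) / 2"
    if "(x, t) \<in> D" for x t
    by (rule dx_eqI[OF assms(1) that refl],
        unfold has_real_derivative_iff_has_vector_derivative[symmetric])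
      (rule derivative_eq_intros der that refl | simp)+
  moreover have "dt (\<lambda>x t. (\<theta>' x t + \<theta> x t) / 2) x t = (dt \<theta>' x t + dt \<theta> x t) / 2"
    if "(x, t) \<in> D" for x t
    by (rule dt_eqI[OF assms(1) that refl],
        unfold has_real_derivative_iff_has_vector_derivative[symmetric])
      (rule derivative_eq_intros der that refl | simp)+
  \<comment> \<open>The two Baecklund equations, solved for the partial derivatives of
    \<open>\<theta>'\<close>.\<close>
  ultimately have d1: "dx \<theta>' x t = 4 * lam * sin (\<psi> x t) - dx \<theta> x t"
    and dt: "dt \<theta>' x t = 2 * (- lam * ((dx \<theta> x t)^2 + 8 * lam^2) * sin (\<psi> x t)
         + 2 * lam * dx (dx \<theta>) x t * cos (\<psi> x t) + 4 * lam^2 * dx \<theta> x t) - dt \<theta> x t"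
    if "(x, t) \<in> D" for x t
    using assms(3) that by (fastforce simp: backlund_transform_def \<psi>_def)+
  \<comment> \<open>Eliminating the derivative of \<open>\<theta>'\<close> by \<open>d1\<close>
    leaves only \<open>\<psi>\<close> and the derivative of \<open>\<theta>\<close>. Hence repeated
    differentiation of \<open>d1\<close> in \<open>x\<close> never reintroduces
    \<open>\<theta>'\<close> except through \<open>\<psi>\<close>.\<close>
  have d\<psi>:
    "((\<lambda>s. \<psi> s t) has_real_derivative 2 * lam * sin (\<psi> x t) - dx \<theta> x t) (at x)"
    if "(x, t) \<in> D" for x t
  proof -
    have "((\<lambda>s. \<psi> s t) has_real_derivative (dx \<theta>' x t - dx \<theta> x t) / 2) (at x)"
      unfolding \<psi>_def by (intro DERIV_cdivide DERIV_diff der that)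
    also have "(dx \<theta>' x t - dx \<theta> x t) / 2 = 2 * lam * sin (\<psi> x t) - dx \<theta> x t"
      by (simp add: d1[OF that])
    finally show ?thesis .
  qed
  have d2: "dx (dx \<theta>') x t
      = 4 * lam * (cos (\<psi> x t) * (2 * lam * sin (\<psi> x t) - dx \<theta> x t)) - dx (dx \<theta>) x t"
    if "(x, t) \<in> D" for x t
    by (rule dx_eqI[OF assms(1) that d1], assumption,
        unfold has_real_derivative_iff_has_vector_derivative[symmetric])
      (rule derivative_eq_intros d\<psi> der that refl | simp)+
  have d3: "dx (dx (dx \<theta>')) x t
      = 4 * lam * (- sin (\<psi> x t) * (2 * lam * sin (\<psi> x t) - dx \<theta> x t)^2
          + cos (\<psi> x t) * (2 * lam * cos (\<psi> x t) * (2 * lam * sin (\<psi> x t) - dx \<theta> x t)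
              - dx (dx \<theta>) x t)) - dx (dx (dx \<theta>)) x t"
    by (rule dx_eqI[OF assms(1) mem d2], assumption,
        unfold has_real_derivative_iff_has_vector_derivative[symmetric])
      (rule derivative_eq_intros d\<psi> der mem refl | simp add: power2_eq_square algebra_simps)+
  \<comment> \<open>After substitution the claim is a polynomial identity in \<open>lam\<close>, the
    sine and cosine of \<open>\<psi>\<close> and the \<open>x\<close>-derivatives of
    \<open>\<theta>\<close>, modulo this relation. The second and third derivatives of
    \<open>\<theta>\<close> cancel directly; the relation is what turns the remaining squares of the
    sine and cosine into the terms \<open>- 16 * lam^3 * sin (\<psi> x t)\<close> and
    \<open>8 * lam^2 * dx \<theta> x t\<close>.\<close>
  have c2: "(cos (\<psi> x t))^2 = 1 - (sin (\<psi> x t))^2"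
    by (simp add: cos_squared_eq)
  show ?thesis
    unfolding dt[OF mem] d3 d1[OF mem] mkdv[OF mem] using c2 by algebra
qed

theorem proposition4p2:
  fixes D :: "(real \<times> real) set"
    and \<gamma> :: "real \<Rightarrow> real \<Rightarrow> real^2"
    and \<theta> \<theta>' :: "real \<Rightarrow> real \<Rightarrow> real"
    and lam :: real
  assumes "open D"
    and "curve_motion D \<gamma> \<theta>"
    and "lam \<noteq> 0"
    and "backlund_transform D lam \<theta> \<theta>'"
  shows "curve_motion D
           (\<lambda>x t. \<gamma> x t + (1 / lam) *\<^sub>R (rot ((\<theta>' x t - \<theta> x t) / 2) *v dx \<gamma> x t)) \<theta>'"
proof -
  define \<phi> where "\<phi> x t = (\<theta>' x t + \<theta> x t) / 2" for x t
  define \<Gamma> where "\<Gamma> = (\<lambda>x t. \<gamma> x t + (1 / lam) *\<^sub>R (rot ((\<theta>' x t - \<theta> x t) / 2) *v dx \<gamma> x t))"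
  note motion = assms(2)[unfolded curve_motion_iff_mkdv[OF assms(1)]]
  have smooth': "smooth_on D (\<lambda>(x, t). \<theta>' x t)"
    and \<phi>_x: "\<And>x t. (x, t) \<in> D \<Longrightarrow> dx \<phi> x t = 2 * lam * sin ((\<theta>' x t - \<theta> x t) / 2)"
    using assms(4) by (auto simp: backlund_transform_def \<phi>_def[abs_def])
  \<comment> \<open>Rotating the unit tangent adds the angles. This closed form holds on
    \<open>D\<close>, where \<open>dx \<gamma>\<close> is known to be that tangent.\<close>
  have \<Gamma>: "\<Gamma> x t = \<gamma> x t + (1 / lam) *\<^sub>R vector [cos (\<phi> x t), sin (\<phi> x t)]"
    if "(x, t) \<in> D" for x t
  proof -
    have "(\<theta>' x t - \<theta> x t) / 2 + \<theta> x t = \<phi> x t"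
      by (simp add: \<phi>_def field_simps)
    then show ?thesis
      using motion that by (simp add: \<Gamma>_def rot_mult_unit_vector)
  qed
  have smooth_\<phi>: "smooth_on D (\<lambda>(x, t). \<phi> x t)"
    using smooth_on_bounded_linear[OF assms(1) bounded_linear_divide
        smooth_on_add[OF assms(1) smooth' motion[THEN conjunct2, THEN conjunct1]], of 2]
    by (simp add: \<phi>_def case_prod_unfold)
  \<comment> \<open>Smoothness is shown for the closed form and carried over to
    \<open>\<Gamma>\<close>, which agrees with it on \<open>D\<close>.\<close>
  have "smooth_on D (\<lambda>p. (case p of (x, t) \<Rightarrow> \<gamma> x t) + (1 / lam) *\<^sub>R
      vector [cos (case p of (x, t) \<Rightarrow> \<phi> x t), sin (case p of (x, t) \<Rightarrow> \<phi> x t)])"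
    by (intro smooth_on_add smooth_on_bounded_linear[OF _ bounded_linear_scaleR_right]
        smooth_on_unit_vector assms(1) smooth_\<phi> motion[THEN conjunct1])
  then have smooth_\<Gamma>: "smooth_on D (\<lambda>(x, t). \<Gamma> x t)"
    by (rule smooth_on_cong[OF assms(1), rotated]) (auto simp: \<Gamma>)
  have "dx \<Gamma> x t = vector [cos (\<theta>' x t), sin (\<theta>' x t)]" if "(x, t) \<in> D" for x t
  proof -
    define \<psi> where "\<psi> = (\<theta>' x t - \<theta> x t) / 2"
    have angles: "\<theta> x t = \<phi> x t - \<psi>" "\<theta>' x t = \<phi> x t + \<psi>"
      by (simp_all add: \<phi>_def \<psi>_def field_simps)
    have "dx \<Gamma> x t = dx \<gamma> x t + (1 / lam) *\<^sub>R (dx \<phi> x t *\<^sub>R vector [- sin (\<phi> x t), cos (\<phi> x t)])"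
      by (rule dx_eqI[OF assms(1) that \<Gamma>], assumption)
        (intro has_vector_derivative_add
          bounded_linear.has_vector_derivative[OF bounded_linear_scaleR_right]
          has_vector_derivative_unit_vector dx_has_vector_derivative[OF _ that] smooth_\<phi>
          motion[THEN conjunct1])
    \<comment> \<open>The factor \<open>1 / lam\<close> cancels against the \<open>lam\<close> in
      \<open>\<phi>_x\<close>; here \<open>lam \<noteq> 0\<close> is used.\<close>
    also have "\<dots> = vector [cos (\<phi> x t - \<psi>), sin (\<phi> x t - \<psi>)]
        + (2 * sin \<psi>) *\<^sub>R vector [- sin (\<phi> x t), cos (\<phi> x t)]"
      using motion that assms(3) \<phi>_x[OF that, folded \<psi>_def] by (simp flip: angles(1))
    \<comment> \<open>Sum-to-product: \<open>cos (\<phi> + \<psi>) - cos (\<phi> - \<psi>) = - 2 *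
      sin \<phi> * sin \<psi>\<close>, and the corresponding difference of sines is
      \<open>2 * cos \<phi> * sin \<psi>\<close>.\<close>
    also have "\<dots> = vector [cos (\<phi> x t + \<psi>), sin (\<phi> x t + \<psi>)]"
      by (simp add: vec_eq_iff forall_2 cos_add sin_add cos_diff sin_diff)
    finally show ?thesis by (simp only: angles(2))
  qed
  then show ?thesis
    unfolding curve_motion_iff_mkdv[OF assms(1)] \<Gamma>_def[symmetric]
    using smooth_\<Gamma> smooth' motion backlund_transform_mkdv[OF assms(1) _ assms(4)] by blast
qed

end
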